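(* Let $n\ge 3$ and $k\ge 1$, and let $UV_n(k)$ be the universal virtual braid group with generators $\rho_i,\sigma_{i,t}$ ($1\le i\le n-1$, $1\le t\le k$). For each $\ell=1,\dots,k$ define $\zeta_\ell\colon UV_n(k)\to UV_n(k)$ on generators by $$\zeta_\ell(\rho_i)=\rho_i,\qquad \zeta_\ell(\sigma_{i,\ell})=\rho_i\sigma_{i,\ell}\rho_i,\qquad \zeta_\ell(\sigma_{i,t})=\sigma_{i,t}\quad (t\ne \ell)$$ for all $i=1,\dots,n-1$, and define $\theta\colon UV_n(k)\to UV_n(k)$ on generators by $$\theta(\rho_i)=\rho_i,\qquad \theta(\sigma_{i,t})=\sigma_{i,t}^{-1}$$ for all $i=1,\dots,n-1$ and $t=1,\dots,k$. Then $\theta,\zeta_1,\dots,\zeta_k$ (are well-defined automorphisms and) induce commuting involutions in $\operatorname{Out}(UV_n(k))$ generating a subgroup isomorphic to $(\mathbb{Z}_2)^{k+1}$.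
   Context: The universal virtual braid group $UV_n(k)$ on $n$ strands with $k$ types of crossings is the group with generators $\rho_i,\sigma_{i,t}$ ($1\le i\le n-1$, $1\le t\le k$) and defining relations: (1) $\rho_i^2=1$; $\rho_i\rho_{i+1}\rho_i=\rho_{i+1}\rho_i\rho_{i+1}$ for $1\le i\le n-2$; $\rho_i\rho_j=\rho_j\rho_i$ for $|i-j|\ge 2$; (2) $\sigma_{i,t}\sigma_{j,\ell}=\sigma_{j,\ell}\sigma_{i,t}$ for $|i-j|\ge 2$ and all $1\le t,\ell\le k$; (3) $\sigma_{i,t}\rho_j=\rho_j\sigma_{i,t}$ for $|i-j|\ge 2$, $1\le t\le k$; (4) $\rho_i\rho_{i+1}\sigma_{i,t}=\sigma_{i+1,t}\rho_i\rho_{i+1}$ for $1\le i\le n-2$, $1\le t\le k$. $\operatorname{Out}(G)=\operatorname{Aut}(G)/\operatorname{Inn}(G)$, and $\mathbb{Z}_2=\mathbb{Z}/2\mathbb{Z}$. *)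

theory Defs
  imports "HOL-Algebra.Algebra"
begin

section \<open>Groups given by generators and relations\<close>

text \<open>A letter \<open>(a, True)\<close> stands for the generator \<open>a\<close>, and \<open>(a, False)\<close> for its formal inverse.\<close>

type_synonym 'a gword = "('a \<times> bool) list"

definition gwords :: "'a set \<Rightarrow> 'a gword set"
  where "gwords S = lists (S \<times> UNIV)"

text \<open>The least congruence on the words over \<open>S\<close> which contains free cancellation and every
  relation \<open>r = s\<close> of \<open>R\<close>.\<close>

inductive pres_eq :: "'a set \<Rightarrow> ('a gword \<times> 'a gword) set \<Rightarrow> 'a gword \<Rightarrow> 'a gword \<Rightarrow> bool"
  for S R where
  refl: "w \<in> gwords S \<Longrightarrow> pres_eq S R w w"
| sym: "pres_eq S R v w \<Longrightarrow> pres_eq S R w v"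
| trans: "pres_eq S R u v \<Longrightarrow> pres_eq S R v w \<Longrightarrow> pres_eq S R u w"
| cancel: "u \<in> gwords S \<Longrightarrow> v \<in> gwords S \<Longrightarrow> a \<in> S
    \<Longrightarrow> pres_eq S R (u @ [(a, b), (a, \<not> b)] @ v) (u @ v)"
| rel: "u \<in> gwords S \<Longrightarrow> v \<in> gwords S \<Longrightarrow> (r, s) \<in> R \<Longrightarrow> r \<in> gwords S \<Longrightarrow> s \<in> gwords S
    \<Longrightarrow> pres_eq S R (u @ r @ v) (u @ s @ v)"

definition pres_rel :: "'a set \<Rightarrow> ('a gword \<times> 'a gword) set \<Rightarrow> ('a gword \<times> 'a gword) set"
  where "pres_rel S R = {(v, w). pres_eq S R v w}"

definition pres_class :: "'a set \<Rightarrow> ('a gword \<times> 'a gword) set \<Rightarrow> 'a gword \<Rightarrow> 'a gword set"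
  where "pres_class S R w = pres_rel S R `` {w}"

definition pres_group :: "'a set \<Rightarrow> ('a gword \<times> 'a gword) set \<Rightarrow> 'a gword set monoid"
  where "pres_group S R =
    \<lparr>carrier = gwords S // pres_rel S R,
     monoid.mult = (\<lambda>A B. \<Union>u\<in>A. \<Union>v\<in>B. pres_class S R (u @ v)),
     one = pres_class S R []\<rparr>"

definition pres_gen :: "'a set \<Rightarrow> ('a gword \<times> 'a gword) set \<Rightarrow> 'a \<Rightarrow> 'a gword set"
  where "pres_gen S R a = pres_class S R [(a, True)]"

lemma gwords_Nil [simp]: "[] \<in> gwords S"
  and gwords_append [simp]: "u @ v \<in> gwords S \<longleftrightarrow> u \<in> gwords S \<and> v \<in> gwords S"
  and gwords_Cons [simp]: "x # v \<in> gwords S \<longleftrightarrow> fst x \<in> S \<and> v \<in> gwords S"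
  by (auto simp: gwords_def mem_Times_iff)

lemma pres_eq_gwords: "pres_eq S R v w \<Longrightarrow> v \<in> gwords S \<and> w \<in> gwords S"
  by (induction rule: pres_eq.induct) auto

lemma equiv_pres_rel: "equiv (gwords S) (pres_rel S R)"
  unfolding pres_rel_def
  by (rule equivI) (auto simp: refl_on_def sym_on_def trans_on_def dest: pres_eq_gwords
      intro: pres_eq.refl pres_eq.sym pres_eq.trans)

lemma pres_eq_context:
  assumes "pres_eq S R v w" "x \<in> gwords S" "y \<in> gwords S"
  shows "pres_eq S R (x @ v @ y) (x @ w @ y)"
  using assms(1)
proof (induction rule: pres_eq.induct)
  case (cancel u v a b)
  then show ?case using pres_eq.cancel[of "x @ u" S "v @ y" a R b] assms(2,3) by simp
next
  case (rel u v r s)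
  then show ?case using pres_eq.rel[of "x @ u" S "v @ y" r s R] assms(2,3) by simp
qed (use assms(2,3) in \<open>auto intro: pres_eq.refl pres_eq.sym pres_eq.trans\<close>)

lemma pres_eq_append:
  assumes "pres_eq S R u u'" "pres_eq S R v v'"
  shows "pres_eq S R (u @ v) (u' @ v')"
proof -
  have "pres_eq S R (u @ v) (u' @ v)"
    using pres_eq_context[OF assms(1), of "[]" v] pres_eq_gwords[OF assms(2)] by simp
  moreover have "pres_eq S R (u' @ v) (u' @ v')"
    using pres_eq_context[OF assms(2), of u' "[]"] pres_eq_gwords[OF assms(1)] by simp
  ultimately show ?thesis by (rule pres_eq.trans)
qed

lemma pres_class_eq_iff:
  assumes "v \<in> gwords S" "w \<in> gwords S"
  shows "pres_class S R v = pres_class S R w \<longleftrightarrow> pres_eq S R v w"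
  using eq_equiv_class_iff[OF equiv_pres_rel assms, of R] by (simp add: pres_class_def pres_rel_def)

lemma carrier_pres_group: "carrier (pres_group S R) = pres_class S R ` gwords S"
  by (auto simp: pres_group_def quotient_def pres_class_def)

lemma one_pres_group: "\<one>\<^bsub>pres_group S R\<^esub> = pres_class S R []"
  by (simp add: pres_group_def)

lemma mult_pres_group:
  assumes "u \<in> gwords S" "v \<in> gwords S"
  shows "pres_class S R u \<otimes>\<^bsub>pres_group S R\<^esub> pres_class S R v = pres_class S R (u @ v)"
proof -
  have "(\<lambda>u v. pres_class S R (u @ v)) respects2 pres_rel S R"
  proof (rule congruent2I')
    fix u u' v v' assume "(u, u') \<in> pres_rel S R" "(v, v') \<in> pres_rel S R"
    then have "pres_eq S R (u @ v) (u' @ v')" by (simp add: pres_rel_def pres_eq_append)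
    with pres_eq_gwords[OF this] show "pres_class S R (u @ v) = pres_class S R (u' @ v')"
      by (subst pres_class_eq_iff) auto
  qed
  from UN_equiv_class2[OF equiv_pres_rel equiv_pres_rel this assms]
  show ?thesis by (simp add: pres_group_def pres_class_def)
qed

lemma pres_eq_inverse:
  "w \<in> gwords S \<Longrightarrow> pres_eq S R (rev (map (\<lambda>(a, b). (a, \<not> b)) w) @ w) []"
proof (induction w)
  case Nil
  then show ?case by (simp add: pres_eq.refl)
next
  case (Cons x w)
  obtain a b where x: "x = (a, b)" by fastforce
  have w: "w \<in> gwords S" "a \<in> S" using Cons.prems x by auto
  then have "rev (map (\<lambda>(a, b). (a, \<not> b)) w) \<in> gwords S"
    using pres_eq_gwords[OF Cons.IH] by simp
  then have "pres_eq S R (rev (map (\<lambda>(a, b). (a, \<not> b)) w) @ [(a, \<not> b), (a, \<not> \<not> b)] @ w)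
      (rev (map (\<lambda>(a, b). (a, \<not> b)) w) @ w)"
    by (intro pres_eq.cancel w)
  from pres_eq.trans[OF this Cons.IH[OF w(1)]] show ?case by (simp add: x)
qed

theorem group_pres_group: "group (pres_group S R)"
proof (rule groupI)
  fix A assume "A \<in> carrier (pres_group S R)"
  then obtain w where w: "w \<in> gwords S" "A = pres_class S R w"
    by (auto simp: carrier_pres_group)
  let ?v = "rev (map (\<lambda>(a, b). (a, \<not> b)) w)"
  have v: "pres_eq S R (?v @ w) []" using w by (intro pres_eq_inverse)
  then have "?v \<in> gwords S" using pres_eq_gwords by fastforce
  with v w show "\<exists>B\<in>carrier (pres_group S R). B \<otimes>\<^bsub>pres_group S R\<^esub> A = \<one>\<^bsub>pres_group S R\<^esub>"
    by (intro bexI[of _ "pres_class S R ?v"])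
      (auto simp: carrier_pres_group one_pres_group mult_pres_group pres_class_eq_iff)
qed (auto simp: carrier_pres_group one_pres_group mult_pres_group)


section \<open>Outer automorphisms\<close>

definition inner_aut :: "('a, 'b) monoid_scheme \<Rightarrow> 'a \<Rightarrow> 'a \<Rightarrow> 'a"
  where "inner_aut G g = (\<lambda>x\<in>carrier G. g \<otimes>\<^bsub>G\<^esub> x \<otimes>\<^bsub>G\<^esub> inv\<^bsub>G\<^esub> g)"

definition Inn :: "('a, 'b) monoid_scheme \<Rightarrow> ('a \<Rightarrow> 'a) set"
  where "Inn G = inner_aut G ` carrier G"

definition Out :: "('a, 'b) monoid_scheme \<Rightarrow> ('a \<Rightarrow> 'a) set monoid"
  where "Out G = AutoGroup G Mod Inn G"

definition out_class :: "('a, 'b) monoid_scheme \<Rightarrow> ('a \<Rightarrow> 'a) \<Rightarrow> ('a \<Rightarrow> 'a) set"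
  where "out_class G f = Inn G #>\<^bsub>AutoGroup G\<^esub> f"


lemma (in group) inner_aut_in_auto:
  assumes "g \<in> carrier G"
  shows "inner_aut G g \<in> auto G"
proof -
  have hom: "inner_aut G g \<in> hom G G"
    using assms by (intro homI) (simp_all add: inner_aut_def m_assoc inv_solve_left)
  have cancel: "x \<otimes> (inv x \<otimes> y) = y" "inv x \<otimes> (x \<otimes> y) = y"
    if "x \<in> carrier G" "y \<in> carrier G" for x y
    using that by (simp_all flip: m_assoc)
  have "bij_betw (inner_aut G g) (carrier G) (carrier G)"
  proof (rule bij_betw_byWitness[where f' = "inner_aut G (inv g)"])
    show "\<forall>x\<in>carrier G. inner_aut G (inv g) (inner_aut G g x) = x"
      "\<forall>x\<in>carrier G. inner_aut G g (inner_aut G (inv g) x) = x"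
      using assms by (simp_all add: inner_aut_def m_assoc cancel)
  qed (use assms in \<open>auto simp: inner_aut_def\<close>)
  with hom show ?thesis
    by (simp add: auto_def Bij_def inner_aut_def)
qed

lemma mult_AutoGroup:
  "f \<in> auto G \<Longrightarrow> h \<in> auto G \<Longrightarrow> f \<otimes>\<^bsub>AutoGroup G\<^esub> h = compose (carrier G) f h"
  by (simp add: AutoGroup_def BijGroup_def auto_def)

lemma one_AutoGroup: "\<one>\<^bsub>AutoGroup G\<^esub> = (\<lambda>x\<in>carrier G. x)"
  by (simp add: AutoGroup_def BijGroup_def)

lemma carrier_AutoGroup: "carrier (AutoGroup G) = auto G"
  by (simp add: AutoGroup_def)

lemma (in group) inner_aut_mult:
  assumes "g \<in> carrier G" "h \<in> carrier G"
  shows "inner_aut G g \<otimes>\<^bsub>AutoGroup G\<^esub> inner_aut G h = inner_aut G (g \<otimes> h)"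
  unfolding mult_AutoGroup[OF inner_aut_in_auto[OF assms(1)] inner_aut_in_auto[OF assms(2)]]
  using assms by (auto simp: compose_def inner_aut_def m_assoc inv_mult_group fun_eq_iff)

lemma (in group) inner_aut_one: "inner_aut G \<one> = \<one>\<^bsub>AutoGroup G\<^esub>"
  by (auto simp: inner_aut_def one_AutoGroup fun_eq_iff)

theorem (in group) Inn_normal: "Inn G \<lhd> AutoGroup G"
proof -
  interpret A: group "AutoGroup G" by (rule AutoGroup)
  have inv: "inv\<^bsub>AutoGroup G\<^esub> (inner_aut G g) = inner_aut G (inv g)" if "g \<in> carrier G" for g
    using that by (intro A.inv_equality)
      (simp_all add: inner_aut_mult inner_aut_one carrier_AutoGroup inner_aut_in_auto)
  have sub: "subgroup (Inn G) (AutoGroup G)"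
  proof (rule A.subgroupI)
    show "Inn G \<subseteq> carrier (AutoGroup G)" "Inn G \<noteq> {}"
      by (auto simp: Inn_def carrier_AutoGroup inner_aut_in_auto)
  qed (auto simp: Inn_def inv inner_aut_mult)
  have conj: "f \<otimes>\<^bsub>AutoGroup G\<^esub> inner_aut G g = inner_aut G (f g) \<otimes>\<^bsub>AutoGroup G\<^esub> f"
    if f: "f \<in> auto G" and g: "g \<in> carrier G" for f g
  proof -
    have hf: "f \<in> hom G G" using f by (simp add: auto_def)
    interpret f: group_hom G G f by unfold_locales (rule hf)
    show ?thesis
      unfolding mult_AutoGroup[OF f inner_aut_in_auto[OF g]]
        mult_AutoGroup[OF inner_aut_in_auto[OF f.hom_closed[OF g]] f]
      using g by (auto simp: compose_def inner_aut_def fun_eq_iff)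
  qed
  show ?thesis unfolding A.normal_inv_iff
  proof (intro conjI sub ballI)
    fix f h assume f: "f \<in> carrier (AutoGroup G)" and "h \<in> Inn G"
    then obtain g where g: "g \<in> carrier G" "h = inner_aut G g" by (auto simp: Inn_def)
    have fg: "f g \<in> carrier G" using f g by (auto simp: carrier_AutoGroup auto_def hom_def)
    have "f \<otimes>\<^bsub>AutoGroup G\<^esub> h \<otimes>\<^bsub>AutoGroup G\<^esub> inv\<^bsub>AutoGroup G\<^esub> f = inner_aut G (f g)"
      using f g conj[of f g] inner_aut_in_auto[OF fg]
      by (simp add: A.m_assoc flip: carrier_AutoGroup)
    then show "f \<otimes>\<^bsub>AutoGroup G\<^esub> h \<otimes>\<^bsub>AutoGroup G\<^esub> inv\<^bsub>AutoGroup G\<^esub> f \<in> Inn G"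
      using fg by (simp add: Inn_def)
  qed
qed

corollary (in group) group_Out: "group (Out G)"
  unfolding Out_def using Inn_normal by (rule normal.factorgroup_is_group)


section \<open>The universal virtual braid group\<close>

datatype uv_gen = Rho nat | Sigma nat nat

definition uv_gens :: "nat \<Rightarrow> nat \<Rightarrow> uv_gen set"
  where "uv_gens n k = {Rho i | i. i \<in> {1..n-1}} \<union> {Sigma i t | i t. i \<in> {1..n-1} \<and> t \<in> {1..k}}"

abbreviation (input) \<rho> :: "nat \<Rightarrow> uv_gen \<times> bool"
  where "\<rho> i \<equiv> (Rho i, True)"

abbreviation (input) \<sigma> :: "nat \<Rightarrow> nat \<Rightarrow> uv_gen \<times> bool"
  where "\<sigma> i t \<equiv> (Sigma i t, True)"

abbreviation far :: "nat \<Rightarrow> nat \<Rightarrow> bool"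
  where "far i j \<equiv> \<bar>int i - int j\<bar> \<ge> 2"

definition uv_rels :: "nat \<Rightarrow> nat \<Rightarrow> (uv_gen gword \<times> uv_gen gword) set"
  where "uv_rels n k =
      {([\<rho> i, \<rho> i], []) | i. i \<in> {1..n-1}}
    \<union> {([\<rho> i, \<rho> (i+1), \<rho> i], [\<rho> (i+1), \<rho> i, \<rho> (i+1)]) | i. i \<in> {1..n-2}}
    \<union> {([\<rho> i, \<rho> j], [\<rho> j, \<rho> i]) | i j. i \<in> {1..n-1} \<and> j \<in> {1..n-1} \<and> far i j}
    \<union> {([\<sigma> i t, \<sigma> j l], [\<sigma> j l, \<sigma> i t]) | i j t l.
         i \<in> {1..n-1} \<and> j \<in> {1..n-1} \<and> far i j \<and> t \<in> {1..k} \<and> l \<in> {1..k}}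
    \<union> {([\<sigma> i t, \<rho> j], [\<rho> j, \<sigma> i t]) | i j t.
         i \<in> {1..n-1} \<and> j \<in> {1..n-1} \<and> far i j \<and> t \<in> {1..k}}
    \<union> {([\<rho> i, \<rho> (i+1), \<sigma> i t], [\<sigma> (i+1) t, \<rho> i, \<rho> (i+1)]) | i t. i \<in> {1..n-2} \<and> t \<in> {1..k}}"

definition UV :: "nat \<Rightarrow> nat \<Rightarrow> uv_gen gword set monoid"
  where "UV n k = pres_group (uv_gens n k) (uv_rels n k)"

definition uv_rho :: "nat \<Rightarrow> nat \<Rightarrow> nat \<Rightarrow> uv_gen gword set"
  where "uv_rho n k i = pres_gen (uv_gens n k) (uv_rels n k) (Rho i)"

definition uv_sigma :: "nat \<Rightarrow> nat \<Rightarrow> nat \<Rightarrow> nat \<Rightarrow> uv_gen gword set"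
  where "uv_sigma n k i t = pres_gen (uv_gens n k) (uv_rels n k) (Sigma i t)"

text \<open>Maps prescribed on generators are described as endomorphisms with the given values there;
  they are extensional, as are the elements of \<^const>\<open>auto\<close>, so that equality of functions is
  equality on the group.\<close>

definition uv_endo :: "nat \<Rightarrow> nat \<Rightarrow> (uv_gen gword set \<Rightarrow> uv_gen gword set) set"
  where "uv_endo n k = hom (UV n k) (UV n k) \<inter> extensional (carrier (UV n k))"

definition is_theta :: "nat \<Rightarrow> nat \<Rightarrow> (uv_gen gword set \<Rightarrow> uv_gen gword set) \<Rightarrow> bool"
  where "is_theta n k f \<longleftrightarrow> f \<in> uv_endo n k \<and>
    (\<forall>i\<in>{1..n-1}. f (uv_rho n k i) = uv_rho n k i) \<and>
    (\<forall>i\<in>{1..n-1}. \<forall>t\<in>{1..k}. f (uv_sigma n k i t) = inv\<^bsub>UV n k\<^esub> (uv_sigma n k i t))"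

definition is_zeta :: "nat \<Rightarrow> nat \<Rightarrow> nat \<Rightarrow> (uv_gen gword set \<Rightarrow> uv_gen gword set) \<Rightarrow> bool"
  where "is_zeta n k l f \<longleftrightarrow> f \<in> uv_endo n k \<and>
    (\<forall>i\<in>{1..n-1}. f (uv_rho n k i) = uv_rho n k i) \<and>
    (\<forall>i\<in>{1..n-1}. f (uv_sigma n k i l)
       = uv_rho n k i \<otimes>\<^bsub>UV n k\<^esub> uv_sigma n k i l \<otimes>\<^bsub>UV n k\<^esub> uv_rho n k i) \<and>
    (\<forall>i\<in>{1..n-1}. \<forall>t\<in>{1..k} - {l}. f (uv_sigma n k i t) = uv_sigma n k i t)"

end

theory Submission
  imports Defs
begin

text \<open>
  For a subset \<open>K\<close> of \<open>{1..k + 1}\<close> consider the endomorphism that fixes every \<open>\<rho>\<^sub>i\<close>, conjugates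
  \<open>\<sigma>\<^sub>i\<^sub>,\<^sub>t\<close> by \<open>\<rho>\<^sub>i\<close> if \<open>t \<in> K\<close>, and then inverts the image of each \<open>\<sigma>\<^sub>i\<^sub>,\<^sub>t\<close> if \<open>k + 1 \<in> K\<close>. It exists by the
  universal property of the presentation (\<open>UV_hom_ex1\<close>), since the relations survive the change
  (\<open>uv_system_twist\<close>). The maps \<open>\<zeta>\<^sub>l\<close> and \<open>\<theta>\<close> are those given by the singletons \<open>{l}\<close> and \<open>{k + 1}\<close>.
  Because conjugation by the involution \<open>\<rho>\<^sub>i\<close> and inversion commute and square to the identity,
  twists compose by symmetric difference of the sets (\<open>compose_twist\<close>). So they form a homomorphic
  image of the power set of \<open>{1..k + 1}\<close>, an elementary abelian 2-group, and the theorem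
  amounts to the claim that no twist by a nonempty \<open>K\<close> is inner (\<open>twist_not_inner\<close>).

  Suppose the twist by \<open>K\<close> is conjugation by \<open>g\<close>. The exponent sum in the \<open>\<sigma>\<close>'s is invariant under
  conjugation, but \<open>\<theta>\<close> changes its sign; so \<open>k + 1 \<notin> K\<close>. Hence some \<open>l \<le> k\<close> lies in \<open>K\<close>, and
  \<open>g \<sigma>\<^sub>1\<^sub>,\<^sub>l g\<^sup>-\<^sup>1 = \<rho>\<^sub>1 \<sigma>\<^sub>1\<^sub>,\<^sub>l \<rho>\<^sub>1\<close> while \<open>g\<close> commutes with all \<open>\<rho>\<^sub>i\<close>. Now map to the signed permutations of
  \<open>n\<close> points, \<open>\<rho>\<^sub>i\<close> to the swap of \<open>i\<close> and \<open>i + 1\<close> and \<open>\<sigma>\<^sub>i\<^sub>,\<^sub>t\<close> to the change of the sign at \<open>i\<close>. There \<open>\<rho>\<^sub>2\<close>,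
  which exists as \<open>n \<ge> 3\<close>, commutes with the sign change at \<open>1\<close> and with \<open>g\<close>, hence also with the conjugate of that sign
  change by \<open>g\<close>. This is the sign change at \<open>2\<close>, with which \<open>\<rho>\<^sub>2\<close> does not commute.
\<close>

section \<open>Homomorphisms out of a presented group\<close>

definition word_eval :: "('b, 'c) monoid_scheme \<Rightarrow> ('a \<Rightarrow> 'b) \<Rightarrow> 'a gword \<Rightarrow> 'b"
  where "word_eval G \<phi> w =
    foldr (\<lambda>(a, b) x. (if b then \<phi> a else inv\<^bsub>G\<^esub> (\<phi> a)) \<otimes>\<^bsub>G\<^esub> x) w \<one>\<^bsub>G\<^esub>"

lemma word_eval_Nil [simp]: "word_eval G \<phi> [] = \<one>\<^bsub>G\<^esub>"
  and word_eval_Cons [simp]: "word_eval G \<phi> ((a, b) # w) =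
    (if b then \<phi> a else inv\<^bsub>G\<^esub> (\<phi> a)) \<otimes>\<^bsub>G\<^esub> word_eval G \<phi> w"
  by (simp_all add: word_eval_def)

context group
begin

lemma word_eval_closed [simp]:
  assumes "\<phi> \<in> S \<rightarrow> carrier G" "w \<in> gwords S"
  shows "word_eval G \<phi> w \<in> carrier G"
  using assms by (induction w) (auto simp: Pi_iff)

lemma word_eval_append:
  assumes "\<phi> \<in> S \<rightarrow> carrier G" "v \<in> gwords S" "w \<in> gwords S"
  shows "word_eval G \<phi> (v @ w) = word_eval G \<phi> v \<otimes> word_eval G \<phi> w"
  using assms(2)
proof (induction v)
  case Nil
  then show ?case using assms by simp
next
  case (Cons x v)
  obtain a b where x: "x = (a, b)" by fastforce
  with Cons.prems have av: "v \<in> gwords S" and "\<phi> a \<in> carrier G" using assms(1) by auto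
  moreover have "word_eval G \<phi> v \<in> carrier G" "word_eval G \<phi> w \<in> carrier G"
    using assms av by auto
  ultimately show ?case using Cons.IH by (simp add: x m_assoc)
qed

lemma word_eval_pres_eq:
  assumes \<phi>: "\<phi> \<in> S \<rightarrow> carrier G"
    and R: "\<And>v w. (v, w) \<in> R \<Longrightarrow> v \<in> gwords S \<Longrightarrow> w \<in> gwords S \<Longrightarrow> word_eval G \<phi> v = word_eval G \<phi> w"
    and "pres_eq S R v w"
  shows "word_eval G \<phi> v = word_eval G \<phi> w"
  using assms(3)
proof (induction rule: pres_eq.induct)
  case (cancel u v a b)
  then have a: "\<phi> a \<in> carrier G" using \<phi> by auto
  have "word_eval G \<phi> [(a, b), (a, \<not> b)] = \<one>" using a by simp
  then show ?case
    using cancel word_eval_append[OF \<phi>, of u "[(a, b), (a, \<not> b)] @ v"]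
      word_eval_append[OF \<phi>, of "[(a, b), (a, \<not> b)]" v] word_eval_append[OF \<phi>, of u v]
      word_eval_closed[OF \<phi>, of v]
    by (simp del: word_eval_Cons append_Cons append_Nil)
next
  case (rel u v r s)
  then show ?case by (simp add: word_eval_append[OF \<phi>] R)
qed auto

text \<open>A map on the generators under which both sides of every relation have the same value
  extends to the presented group: the value of a word depends only on its class.\<close>

lemma pres_group_lift:
  assumes \<phi>: "\<phi> \<in> S \<rightarrow> carrier G"
    and R: "\<And>v w. (v, w) \<in> R \<Longrightarrow> v \<in> gwords S \<Longrightarrow> w \<in> gwords S \<Longrightarrow> word_eval G \<phi> v = word_eval G \<phi> w"
  obtains f where "f \<in> hom (pres_group S R) G" "f \<in> extensional (carrier (pres_group S R))"
    "\<And>a. a \<in> S \<Longrightarrow> f (pres_gen S R a) = \<phi> a"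
proof -
  define f where "f = (\<lambda>C\<in>carrier (pres_group S R).
    word_eval G \<phi> (SOME w. w \<in> gwords S \<and> pres_class S R w = C))"
  have f: "f (pres_class S R w) = word_eval G \<phi> w" if w: "w \<in> gwords S" for w
  proof -
    define v where "v = (SOME v. v \<in> gwords S \<and> pres_class S R v = pres_class S R w)"
    have "v \<in> gwords S \<and> pres_class S R v = pres_class S R w"
      unfolding v_def by (rule someI_ex) (use w in blast)
    then have "pres_eq S R v w" using w pres_class_eq_iff by blast
    then have "word_eval G \<phi> v = word_eval G \<phi> w"
      by (rule word_eval_pres_eq[OF \<phi>, rotated]) (rule R)
    moreover have "pres_class S R w \<in> carrier (pres_group S R)"
      unfolding carrier_pres_group using w by (rule imageI)
    ultimately show ?thesis unfolding f_def v_def by simp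
  qed
  show thesis
  proof
    show "f \<in> hom (pres_group S R) G"
    proof (rule homI)
      fix C assume "C \<in> carrier (pres_group S R)"
      then obtain v where v: "v \<in> gwords S" "C = pres_class S R v"
        unfolding carrier_pres_group by blast
      then show "f C \<in> carrier G" using word_eval_closed[OF \<phi> v(1)] by (simp add: f)
      fix D assume "D \<in> carrier (pres_group S R)"
      then obtain w where w: "w \<in> gwords S" "D = pres_class S R w"
        unfolding carrier_pres_group by blast
      with v show "f (C \<otimes>\<^bsub>pres_group S R\<^esub> D) = f C \<otimes> f D"
        by (simp add: mult_pres_group f word_eval_append[OF \<phi>])
    qed
    show "f \<in> extensional (carrier (pres_group S R))" by (simp add: f_def)
    fix a assume "a \<in> S"
    then have "f (pres_gen S R a) = \<phi> a \<otimes> \<one>" by (simp add: pres_gen_def f)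
    then show "f (pres_gen S R a) = \<phi> a" using \<phi> \<open>a \<in> S\<close> by (simp add: Pi_iff)
  qed
qed

lemma pres_group_hom_unique:
  assumes f: "f \<in> hom (pres_group S R) G" "f \<in> extensional (carrier (pres_group S R))"
    and h: "h \<in> hom (pres_group S R) G" "h \<in> extensional (carrier (pres_group S R))"
    and gen: "\<And>a. a \<in> S \<Longrightarrow> f (pres_gen S R a) = h (pres_gen S R a)"
  shows "f = h"
proof (rule extensionalityI[OF f(2) h(2)])
  interpret P: group "pres_group S R" by (rule group_pres_group)
  interpret f: group_hom "pres_group S R" G f by unfold_locales (rule f)
  interpret h: group_hom "pres_group S R" G h by unfold_locales (rule h)
  have "f (pres_class S R w) = h (pres_class S R w)" if "w \<in> gwords S" for w
    using that
  proof (induction w)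
    case Nil
    then show ?case by (metis f.hom_one h.hom_one one_pres_group)
  next
    case (Cons x w)
    obtain a b where x: "x = (a, b)" by fastforce
    with Cons.prems have a: "a \<in> S" and w: "w \<in> gwords S" by auto
    have car: "pres_class S R v \<in> carrier (pres_group S R)" if "v \<in> gwords S" for v
      using that by (auto simp: carrier_pres_group)
    have "f (pres_class S R [(a, b)]) = h (pres_class S R [(a, b)])"
    proof (cases b)
      case True
      then show ?thesis using gen[OF a] by (simp add: pres_gen_def)
    next
      case False
      have "pres_eq S R ([] @ [(a, False), (a, \<not> False)] @ []) ([] @ [])"
        using a by (intro pres_eq.cancel) auto
      then have "pres_class S R [(a, False)] = inv\<^bsub>pres_group S R\<^esub> (pres_gen S R a)"
        using a by (intro P.inv_equality[symmetric])
          (auto simp: pres_gen_def mult_pres_group one_pres_group pres_class_eq_iff car)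
      moreover have "pres_gen S R a \<in> carrier (pres_group S R)"
        using a by (simp add: pres_gen_def car)
      ultimately show ?thesis using False gen[OF a] by simp
    qed
    moreover have "pres_class S R (x # w) =
        pres_class S R [(a, b)] \<otimes>\<^bsub>pres_group S R\<^esub> pres_class S R w"
      using a w by (simp add: mult_pres_group x)
    ultimately show ?case using Cons.IH[OF w] a w car[of w] car[of "[(a, b)]"] by simp
  qed
  then show "f C = h C" if "C \<in> carrier (pres_group S R)" for C
    using that by (auto simp: carrier_pres_group)
qed


section \<open>Intertwined elements and twists\<close>

text \<open>Every defining relation that involves a \<open>\<sigma>\<close> says that some \<open>w\<close> intertwines two generators,
  \<open>w x = y w\<close>, commutation being the case \<open>x = y\<close>. Intertwining passes to products
  and inverses, hence to the twists below.\<close>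

lemma intertwine_mult:
  assumes "w \<in> carrier G" "x \<in> carrier G" "x' \<in> carrier G" "y \<in> carrier G" "y' \<in> carrier G"
    and "w \<otimes> x = y \<otimes> w" "w \<otimes> x' = y' \<otimes> w"
  shows "w \<otimes> (x \<otimes> x') = (y \<otimes> y') \<otimes> w"
proof -
  have "w \<otimes> (x \<otimes> x') = (y \<otimes> w) \<otimes> x'" using assms(1-3) by (simp flip: assms(6) add: m_assoc)
  also have "\<dots> = y \<otimes> (y' \<otimes> w)" using assms(1-5) by (simp flip: assms(7) add: m_assoc)
  finally show ?thesis using assms(1,4,5) by (simp add: m_assoc)
qed

lemma intertwine_inv:
  assumes "w \<in> carrier G" "x \<in> carrier G" "y \<in> carrier G" and "w \<otimes> x = y \<otimes> w"
  shows "w \<otimes> inv x = inv y \<otimes> w"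
proof -
  have "inv y \<otimes> w = inv y \<otimes> (w \<otimes> x) \<otimes> inv x" using assms(1-3) by (simp add: m_assoc)
  also have "\<dots> = w \<otimes> inv x" unfolding assms(4) using assms(1-3) by (simp flip: m_assoc)
  finally show ?thesis ..
qed

end

text \<open>For \<open>t \<in> {1..k}\<close>, the effect on \<open>x = \<sigma>\<^sub>i\<^sub>,\<^sub>t\<close> of the product of all \<open>\<zeta>\<^sub>l\<close> with \<open>l \<in> K\<close>, and of \<open>\<theta>\<close> if \<open>k + 1 \<in> K\<close>,
  where \<open>a = \<rho>\<^sub>i\<close>. Treating \<open>\<theta>\<close> as the element \<open>k + 1\<close> makes the \<open>2\<^sup>k\<^sup>+\<^sup>1\<close> products correspond to
  the subsets of \<open>{1..k + 1}\<close>.\<close>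

definition uv_twist :: "('b, 'c) monoid_scheme \<Rightarrow> nat \<Rightarrow> nat set \<Rightarrow> nat \<Rightarrow> 'b \<Rightarrow> 'b \<Rightarrow> 'b"
  where "uv_twist G k K t a x =
    (let c = (if t \<in> K then a \<otimes>\<^bsub>G\<^esub> x \<otimes>\<^bsub>G\<^esub> a else x) in if k + 1 \<in> K then inv\<^bsub>G\<^esub> c else c)"

context group
begin

lemma uv_twist_closed [simp]:
  "a \<in> carrier G \<Longrightarrow> x \<in> carrier G \<Longrightarrow> uv_twist G k K t a x \<in> carrier G"
  by (simp add: uv_twist_def Let_def)

lemma uv_twist_intertwine:
  assumes "w \<in> carrier G" "a \<in> carrier G" "b \<in> carrier G" "x \<in> carrier G" "y \<in> carrier G"
    and "w \<otimes> a = b \<otimes> w" "w \<otimes> x = y \<otimes> w"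
  shows "w \<otimes> uv_twist G k K t a x = uv_twist G k K t b y \<otimes> w"
  using assms by (simp add: uv_twist_def Let_def intertwine_mult intertwine_inv)

lemma uv_twist_twist:
  assumes a: "a \<in> carrier G" "a \<otimes> a = \<one>" and x: "x \<in> carrier G"
  shows "uv_twist G k K t a (uv_twist G k L t a x) = uv_twist G k (sym_diff K L) t a x"
proof -
  have "inv a = a" using a by (intro inv_equality)
  moreover have "a \<otimes> (a \<otimes> z) = z" if "z \<in> carrier G" for z
    using a that by (simp flip: m_assoc)
  ultimately show ?thesis using a x by (auto simp: uv_twist_def Let_def inv_mult_group m_assoc)
qed

end

lemma (in group_hom) hom_uv_twist:
  "a \<in> carrier G \<Longrightarrow> x \<in> carrier G \<Longrightarrow> h (uv_twist G k K t a x) = uv_twist H k K t (h a) (h x)"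
  by (simp add: uv_twist_def Let_def)


section \<open>Homomorphisms out of the universal virtual braid group\<close>

text \<open>Families of group elements that satisfy the defining relations, that is, representations of the
  universal virtual braid group in an arbitrary group.\<close>

locale uv_system = group +
  fixes n k :: nat and r :: "nat \<Rightarrow> 'a" and s :: "nat \<Rightarrow> nat \<Rightarrow> 'a"
  assumes r_closed [simp]: "i \<in> {1..n-1} \<Longrightarrow> r i \<in> carrier G"
    and s_closed [simp]: "i \<in> {1..n-1} \<Longrightarrow> t \<in> {1..k} \<Longrightarrow> s i t \<in> carrier G"
    and r_invol: "i \<in> {1..n-1} \<Longrightarrow> r i \<otimes> r i = \<one>"
    and r_braid: "i \<in> {1..n-2} \<Longrightarrow> r i \<otimes> r (i+1) \<otimes> r i = r (i+1) \<otimes> r i \<otimes> r (i+1)"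
    and r_far: "i \<in> {1..n-1} \<Longrightarrow> j \<in> {1..n-1} \<Longrightarrow> far i j \<Longrightarrow> r i \<otimes> r j = r j \<otimes> r i"
    and s_far: "i \<in> {1..n-1} \<Longrightarrow> j \<in> {1..n-1} \<Longrightarrow> far i j \<Longrightarrow> t \<in> {1..k} \<Longrightarrow> l \<in> {1..k} \<Longrightarrow>
      s i t \<otimes> s j l = s j l \<otimes> s i t"
    and sr_far: "i \<in> {1..n-1} \<Longrightarrow> j \<in> {1..n-1} \<Longrightarrow> far i j \<Longrightarrow> t \<in> {1..k} \<Longrightarrow>
      s i t \<otimes> r j = r j \<otimes> s i t"
    and s_slide: "i \<in> {1..n-2} \<Longrightarrow> t \<in> {1..k} \<Longrightarrow>
      r i \<otimes> r (i+1) \<otimes> s i t = s (i+1) t \<otimes> r i \<otimes> r (i+1)"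

lemma uv_system_UV: "uv_system (UV n k) n k (uv_rho n k) (uv_sigma n k)"
proof -
  let ?S = "uv_gens n k" and ?R = "uv_rels n k"
  have rel: "pres_class ?S ?R v = pres_class ?S ?R w"
    if "(v, w) \<in> ?R" "v \<in> gwords ?S" "w \<in> gwords ?S" for v w
    using pres_eq.rel[of "[]" ?S "[]" v w ?R] that by (simp add: pres_class_eq_iff)
  have R1: "([\<rho> i, \<rho> i], []) \<in> ?R" if "i \<in> {1..n-1}" for i
    unfolding uv_rels_def
    by (rule UnI1, rule UnI1, rule UnI1, rule UnI1, rule UnI1, rule CollectI, (rule exI)+, rule conjI, rule HOL.refl, intro conjI that)
  have R2: "([\<rho> i, \<rho> (i+1), \<rho> i], [\<rho> (i+1), \<rho> i, \<rho> (i+1)]) \<in> ?R" if "i \<in> {1..n-2}" for i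
    unfolding uv_rels_def
    by (rule UnI1, rule UnI1, rule UnI1, rule UnI1, rule UnI2, rule CollectI, (rule exI)+, rule conjI, rule HOL.refl, intro conjI that)
  have R3: "([\<rho> i, \<rho> j], [\<rho> j, \<rho> i]) \<in> ?R" if "i \<in> {1..n-1}" "j \<in> {1..n-1}" "far i j" for i j
    unfolding uv_rels_def
    by (rule UnI1, rule UnI1, rule UnI1, rule UnI2, rule CollectI, (rule exI)+, rule conjI, rule HOL.refl, intro conjI that)
  have R4: "([\<sigma> i t, \<sigma> j l], [\<sigma> j l, \<sigma> i t]) \<in> ?R"
    if "i \<in> {1..n-1}" "j \<in> {1..n-1}" "far i j" "t \<in> {1..k}" "l \<in> {1..k}" for i j t l
    unfolding uv_rels_def
    by (rule UnI1, rule UnI1, rule UnI2, rule CollectI, (rule exI)+, rule conjI, rule HOL.refl, intro conjI that)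
  have R5: "([\<sigma> i t, \<rho> j], [\<rho> j, \<sigma> i t]) \<in> ?R"
    if "i \<in> {1..n-1}" "j \<in> {1..n-1}" "far i j" "t \<in> {1..k}" for i j t
    unfolding uv_rels_def
    by (rule UnI1, rule UnI2, rule CollectI, (rule exI)+, rule conjI, rule HOL.refl, intro conjI that)
  have R6: "([\<rho> i, \<rho> (i+1), \<sigma> i t], [\<sigma> (i+1) t, \<rho> i, \<rho> (i+1)]) \<in> ?R"
    if "i \<in> {1..n-2}" "t \<in> {1..k}" for i t
    unfolding uv_rels_def
    by (rule UnI2, rule CollectI, (rule exI)+, rule conjI, rule HOL.refl, intro conjI that)
  have Rho: "Rho i \<in> ?S \<longleftrightarrow> i \<in> {1..n-1}" for i by (auto simp: uv_gens_def)
  have Sigma: "Sigma i t \<in> ?S \<longleftrightarrow> i \<in> {1..n-1} \<and> t \<in> {1..k}" for i t by (auto simp: uv_gens_def)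
  have suc: "i \<in> {1..n-1}" "i+1 \<in> {1..n-1}" if "i \<in> {1..n-2}" for i using that by auto
  interpret group "UV n k" unfolding UV_def by (rule group_pres_group)
  note defs = UV_def uv_rho_def uv_sigma_def pres_gen_def
  show ?thesis
  proof
    fix i t assume "i \<in> {1..n-1}" "t \<in> {1..k}"
    then show "uv_sigma n k i t \<in> carrier (UV n k)"
      unfolding defs carrier_pres_group by (intro imageI) (simp add: Sigma)
  next
    fix i assume i: "i \<in> {1..n-1}"
    then show "uv_rho n k i \<in> carrier (UV n k)"
      unfolding defs carrier_pres_group by (intro imageI) (simp add: Rho)
    show "uv_rho n k i \<otimes>\<^bsub>UV n k\<^esub> uv_rho n k i = \<one>\<^bsub>UV n k\<^esub>"
      using i
      by (simp add: defs mult_pres_group one_pres_group Rho) (rule rel, rule R1[OF i], simp_all add: Rho Sigma)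
  next
    fix i assume i: "i \<in> {1..n-2}"
    \<comment> \<open>The simplifier writes \<open>Suc i\<close> for \<open>i + 1\<close>, and the relation has to match its result.\<close>
    show "uv_rho n k i \<otimes>\<^bsub>UV n k\<^esub> uv_rho n k (i+1) \<otimes>\<^bsub>UV n k\<^esub> uv_rho n k i
        = uv_rho n k (i+1) \<otimes>\<^bsub>UV n k\<^esub> uv_rho n k i \<otimes>\<^bsub>UV n k\<^esub> uv_rho n k (i+1)"
      using suc[OF i]
      by (simp add: defs mult_pres_group Rho) (rule rel, rule R2[OF i, unfolded Suc_eq_plus1[symmetric]], simp_all add: Rho Sigma)
  next
    fix i j assume ij: "i \<in> {1..n-1}" "j \<in> {1..n-1}" "far i j"
    show "uv_rho n k i \<otimes>\<^bsub>UV n k\<^esub> uv_rho n k j = uv_rho n k j \<otimes>\<^bsub>UV n k\<^esub> uv_rho n k i"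
      using ij
      by (simp add: defs mult_pres_group Rho) (rule rel, rule R3[OF ij], simp_all add: Rho Sigma)
  next
    fix i j t l assume ij: "i \<in> {1..n-1}" "j \<in> {1..n-1}" "far i j" "t \<in> {1..k}" "l \<in> {1..k}"
    show "uv_sigma n k i t \<otimes>\<^bsub>UV n k\<^esub> uv_sigma n k j l
        = uv_sigma n k j l \<otimes>\<^bsub>UV n k\<^esub> uv_sigma n k i t"
      using ij
      by (simp add: defs mult_pres_group Sigma) (rule rel, rule R4[OF ij], simp_all add: Rho Sigma)
  next
    fix i j t assume ij: "i \<in> {1..n-1}" "j \<in> {1..n-1}" "far i j" "t \<in> {1..k}"
    show "uv_sigma n k i t \<otimes>\<^bsub>UV n k\<^esub> uv_rho n k j = uv_rho n k j \<otimes>\<^bsub>UV n k\<^esub> uv_sigma n k i t"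
      using ij
      by (simp add: defs mult_pres_group Rho Sigma) (rule rel, rule R5[OF ij], simp_all add: Rho Sigma)
  next
    fix i t assume i: "i \<in> {1..n-2}" and t: "t \<in> {1..k}"
    show "uv_rho n k i \<otimes>\<^bsub>UV n k\<^esub> uv_rho n k (i+1) \<otimes>\<^bsub>UV n k\<^esub> uv_sigma n k i t
        = uv_sigma n k (i+1) t \<otimes>\<^bsub>UV n k\<^esub> uv_rho n k i \<otimes>\<^bsub>UV n k\<^esub> uv_rho n k (i+1)"
      using suc[OF i] t
      by (simp add: defs mult_pres_group Rho Sigma) (rule rel, rule R6[OF i t, unfolded Suc_eq_plus1[symmetric]], simp_all add: Rho Sigma)
  qed
qed

context uv_system
begin

lemma UV_hom_ex1:
  "\<exists>!f. f \<in> hom (UV n k) G \<inter> extensional (carrier (UV n k)) \<and>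
    (\<forall>i\<in>{1..n-1}. f (uv_rho n k i) = r i) \<and>
    (\<forall>i\<in>{1..n-1}. \<forall>t\<in>{1..k}. f (uv_sigma n k i t) = s i t)"
proof -
  let ?S = "uv_gens n k" and ?R = "uv_rels n k"
  define \<phi> where "\<phi> a = (case a of Rho i \<Rightarrow> r i | Sigma i t \<Rightarrow> s i t)" for a
  have \<phi>: "\<phi> \<in> ?S \<rightarrow> carrier G" by (auto simp: \<phi>_def uv_gens_def)
  have suc: "i \<in> {1..n-1}" "i+1 \<in> {1..n-1}" if "i \<in> {1..n-2}" for i using that by auto
  have rels: "word_eval G \<phi> v = word_eval G \<phi> w" if "(v, w) \<in> ?R" for v w
    using that unfolding uv_rels_def Un_iff
  proof (elim disjE)
    assume "(v, w) \<in> {([\<rho> i, \<rho> i], []) | i. i \<in> {1..n-1}}"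
    then show ?thesis by (auto simp: \<phi>_def r_invol)
  next
    assume "(v, w) \<in> {([\<rho> i, \<rho> (i+1), \<rho> i], [\<rho> (i+1), \<rho> i, \<rho> (i+1)]) | i. i \<in> {1..n-2}}"
    then obtain i where i: "i \<in> {1..n-2}"
      and vw: "v = [\<rho> i, \<rho> (i+1), \<rho> i]" "w = [\<rho> (i+1), \<rho> i, \<rho> (i+1)]" by blast
    show ?thesis using r_braid[OF i] r_closed[OF suc(1)[OF i]] r_closed[OF suc(2)[OF i]]
      by (simp add: vw \<phi>_def m_assoc)
  next
    assume "(v, w) \<in> {([\<rho> i, \<rho> j], [\<rho> j, \<rho> i]) | i j. i \<in> {1..n-1} \<and> j \<in> {1..n-1} \<and> far i j}"
    then obtain i j where ij: "i \<in> {1..n-1}" "j \<in> {1..n-1}" "far i j"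
      and vw: "v = [\<rho> i, \<rho> j]" "w = [\<rho> j, \<rho> i]" by blast
    show ?thesis using ij by (simp add: vw \<phi>_def) (rule r_far[OF ij])
  next
    assume "(v, w) \<in> {([\<sigma> i t, \<sigma> j l], [\<sigma> j l, \<sigma> i t]) | i j t l.
         i \<in> {1..n-1} \<and> j \<in> {1..n-1} \<and> far i j \<and> t \<in> {1..k} \<and> l \<in> {1..k}}"
    then obtain i j t l where ij: "i \<in> {1..n-1}" "j \<in> {1..n-1}" "far i j" "t \<in> {1..k}" "l \<in> {1..k}"
      and vw: "v = [\<sigma> i t, \<sigma> j l]" "w = [\<sigma> j l, \<sigma> i t]" by blast
    show ?thesis using ij by (simp add: vw \<phi>_def) (rule s_far[OF ij])
  next
    assume "(v, w) \<in> {([\<sigma> i t, \<rho> j], [\<rho> j, \<sigma> i t]) | i j t.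
         i \<in> {1..n-1} \<and> j \<in> {1..n-1} \<and> far i j \<and> t \<in> {1..k}}"
    then obtain i j t where ij: "i \<in> {1..n-1}" "j \<in> {1..n-1}" "far i j" "t \<in> {1..k}"
      and vw: "v = [\<sigma> i t, \<rho> j]" "w = [\<rho> j, \<sigma> i t]" by blast
    show ?thesis using ij by (simp add: vw \<phi>_def) (rule sr_far[OF ij])
  next
    assume "(v, w) \<in> {([\<rho> i, \<rho> (i+1), \<sigma> i t], [\<sigma> (i+1) t, \<rho> i, \<rho> (i+1)]) | i t.
         i \<in> {1..n-2} \<and> t \<in> {1..k}}"
    then obtain i t where it: "i \<in> {1..n-2}" "t \<in> {1..k}"
      and vw: "v = [\<rho> i, \<rho> (i+1), \<sigma> i t]" "w = [\<sigma> (i+1) t, \<rho> i, \<rho> (i+1)]" by blast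
    show ?thesis
      using s_slide[OF it] r_closed[OF suc(1)[OF it(1)]] r_closed[OF suc(2)[OF it(1)]]
        s_closed[OF suc(1)[OF it(1)] it(2)] s_closed[OF suc(2)[OF it(1)] it(2)]
      by (simp add: vw \<phi>_def m_assoc)
  qed
  obtain f where f: "f \<in> hom (pres_group ?S ?R) G" "f \<in> extensional (carrier (pres_group ?S ?R))"
    "\<And>a. a \<in> ?S \<Longrightarrow> f (pres_gen ?S ?R a) = \<phi> a"
    by (rule pres_group_lift[OF \<phi>, of ?R]) (rule rels, blast+)
  show ?thesis
  proof (rule ex1I)
    show "f \<in> hom (UV n k) G \<inter> extensional (carrier (UV n k)) \<and>
        (\<forall>i\<in>{1..n-1}. f (uv_rho n k i) = r i) \<and>
        (\<forall>i\<in>{1..n-1}. \<forall>t\<in>{1..k}. f (uv_sigma n k i t) = s i t)"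
      using f by (auto simp: UV_def uv_rho_def uv_sigma_def \<phi>_def uv_gens_def)
  next
    fix h
    assume h: "h \<in> hom (UV n k) G \<inter> extensional (carrier (UV n k)) \<and>
        (\<forall>i\<in>{1..n-1}. h (uv_rho n k i) = r i) \<and>
        (\<forall>i\<in>{1..n-1}. \<forall>t\<in>{1..k}. h (uv_sigma n k i t) = s i t)"
    have "h (pres_gen ?S ?R a) = f (pres_gen ?S ?R a)" if "a \<in> ?S" for a
    proof (cases a)
      case (Rho i)
      then have "i \<in> {1..n-1}" using that by (auto simp: uv_gens_def)
      then show ?thesis using h f(3)[OF that] Rho by (auto simp: uv_rho_def \<phi>_def)
    next
      case (Sigma i t)
      then have "i \<in> {1..n-1}" "t \<in> {1..k}" using that by (auto simp: uv_gens_def)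
      then show ?thesis using h f(3)[OF that] Sigma by (auto simp: uv_sigma_def \<phi>_def)
    qed
    then show "h = f" using h f by (intro pres_group_hom_unique) (auto simp: UV_def)
  qed
qed

lemma UV_hom_exists:
  obtains f where "f \<in> hom (UV n k) G" "\<And>i. i \<in> {1..n-1} \<Longrightarrow> f (uv_rho n k i) = r i"
    "\<And>i t. i \<in> {1..n-1} \<Longrightarrow> t \<in> {1..k} \<Longrightarrow> f (uv_sigma n k i t) = s i t"
proof -
  obtain f where "f \<in> hom (UV n k) G \<inter> extensional (carrier (UV n k)) \<and>
    (\<forall>i\<in>{1..n-1}. f (uv_rho n k i) = r i) \<and>
    (\<forall>i\<in>{1..n-1}. \<forall>t\<in>{1..k}. f (uv_sigma n k i t) = s i t)"
    using ex1_implies_ex[OF UV_hom_ex1] by (elim exE)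
  then show thesis by (intro that[of f]) simp_all
qed

text \<open>An element that commutes with \<open>\<rho>\<^sub>i\<close> and \<open>\<sigma>\<^sub>i\<^sub>,\<^sub>t\<close> commutes with the twist of \<open>\<sigma>\<^sub>i\<^sub>,\<^sub>t\<close>; applied twice this
  gives the relations between distant generators. In the mixed relation \<open>w = \<rho>\<^sub>i \<rho>\<^sub>i\<^sub>+\<^sub>1\<close> intertwines not
  only \<open>\<sigma>\<^sub>i\<^sub>,\<^sub>t\<close> with \<open>\<sigma>\<^sub>i\<^sub>+\<^sub>1\<^sub>,\<^sub>t\<close> but, by the braid relation, also \<open>\<rho>\<^sub>i\<close> with \<open>\<rho>\<^sub>i\<^sub>+\<^sub>1\<close>.\<close>

lemma uv_system_twist: "uv_system G n k r (\<lambda>i t. uv_twist G k K t (r i) (s i t))"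
proof
  have far_sym: "far j i" if "far i j" for i j using that by (simp add: abs_minus_commute)
  have rw: "r j \<otimes> uv_twist G k K t (r i) (s i t) = uv_twist G k K t (r i) (s i t) \<otimes> r j"
    if "i \<in> {1..n-1}" "j \<in> {1..n-1}" "far i j" "t \<in> {1..k}" for i j t
    by (rule uv_twist_intertwine[OF _ _ _ _ _ r_far sr_far[symmetric]])
      (intro r_closed s_closed that far_sym[OF that(3)])+
  then show "uv_twist G k K t (r i) (s i t) \<otimes> r j = r j \<otimes> uv_twist G k K t (r i) (s i t)"
    if "i \<in> {1..n-1}" "j \<in> {1..n-1}" "far i j" "t \<in> {1..k}" for i j t
    using that by (intro rw[symmetric])
  have sw: "s j l \<otimes> uv_twist G k K t (r i) (s i t) = uv_twist G k K t (r i) (s i t) \<otimes> s j l"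
    if "i \<in> {1..n-1}" "j \<in> {1..n-1}" "far i j" "t \<in> {1..k}" "l \<in> {1..k}" for i j t l
    by (rule uv_twist_intertwine[OF _ _ _ _ _ sr_far s_far])
      (intro r_closed s_closed that far_sym[OF that(3)])+
  show "uv_twist G k K t (r i) (s i t) \<otimes> uv_twist G k K l (r j) (s j l)
      = uv_twist G k K l (r j) (s j l) \<otimes> uv_twist G k K t (r i) (s i t)"
    if "i \<in> {1..n-1}" "j \<in> {1..n-1}" "far i j" "t \<in> {1..k}" "l \<in> {1..k}" for i j t l
    by (rule uv_twist_intertwine[OF _ _ _ _ _ rw[symmetric] sw[symmetric]])
      (intro r_closed s_closed uv_twist_closed that)+
  show "r i \<otimes> r (i+1) \<otimes> uv_twist G k K t (r i) (s i t)
      = uv_twist G k K t (r (i+1)) (s (i+1) t) \<otimes> r i \<otimes> r (i+1)"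
    if i: "i \<in> {1..n-2}" and t: "t \<in> {1..k}" for i t
  proof -
    have i': "i \<in> {1..n-1}" "i+1 \<in> {1..n-1}" using i by auto
    note closed = r_closed[OF i'(1)] r_closed[OF i'(2)] s_closed[OF i'(1) t] s_closed[OF i'(2) t]
    have "(r i \<otimes> r (i+1)) \<otimes> r i = r (i+1) \<otimes> (r i \<otimes> r (i+1))"
      unfolding r_braid[OF i] by (rule m_assoc[OF closed(2,1,2)])
    moreover have "(r i \<otimes> r (i+1)) \<otimes> s i t = s (i+1) t \<otimes> (r i \<otimes> r (i+1))"
      unfolding s_slide[OF i t] by (rule m_assoc[OF closed(4,1,2)])
    ultimately have "(r i \<otimes> r (i+1)) \<otimes> uv_twist G k K t (r i) (s i t)
        = uv_twist G k K t (r (i+1)) (s (i+1) t) \<otimes> (r i \<otimes> r (i+1))"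
      by (rule uv_twist_intertwine[OF m_closed[OF closed(1,2)] closed])
    then show ?thesis by (simp only: m_assoc uv_twist_closed closed)
  qed
qed (assumption | rule r_closed s_closed uv_twist_closed r_invol r_braid r_far)+

end


section \<open>The twists as automorphisms\<close>

definition is_twist :: "nat \<Rightarrow> nat \<Rightarrow> nat set \<Rightarrow> (uv_gen gword set \<Rightarrow> uv_gen gword set) \<Rightarrow> bool"
  where "is_twist n k K f \<longleftrightarrow> f \<in> uv_endo n k \<and>
    (\<forall>i\<in>{1..n-1}. f (uv_rho n k i) = uv_rho n k i) \<and>
    (\<forall>i\<in>{1..n-1}. \<forall>t\<in>{1..k}. f (uv_sigma n k i t) =
      uv_twist (UV n k) k K t (uv_rho n k i) (uv_sigma n k i t))"

definition twist :: "nat \<Rightarrow> nat \<Rightarrow> nat set \<Rightarrow> uv_gen gword set \<Rightarrow> uv_gen gword set"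
  where "twist n k K = (THE f. is_twist n k K f)"

lemma is_twist_ex1: "\<exists>!f. is_twist n k K f"
  using uv_system.UV_hom_ex1[OF uv_system.uv_system_twist[OF uv_system_UV]]
  by (simp add: is_twist_def uv_endo_def)

lemma is_twist_twist: "is_twist n k K (twist n k K)"
  unfolding twist_def by (rule theI'[OF is_twist_ex1])

lemma is_twist_iff: "is_twist n k K f \<longleftrightarrow> f = twist n k K"
  using is_twist_ex1 is_twist_twist by blast

lemma is_theta_iff: "is_theta n k f \<longleftrightarrow> f = twist n k {k+1}"
  by (auto simp: is_theta_def is_twist_def uv_twist_def Let_def simp flip: is_twist_iff)

lemma is_zeta_iff:
  assumes "l \<in> {1..k}"
  shows "is_zeta n k l f \<longleftrightarrow> f = twist n k {l}"
proof -
  have "is_zeta n k l f \<longleftrightarrow> is_twist n k {l} f"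
    using assms unfolding is_zeta_def is_twist_def uv_twist_def Let_def by auto
  then show ?thesis by (simp add: is_twist_iff)
qed

lemma twist_empty: "twist n k {} = (\<lambda>x\<in>carrier (UV n k). x)"
proof -
  interpret UV: uv_system "UV n k" n k "uv_rho n k" "uv_sigma n k" by (rule uv_system_UV)
  have "is_twist n k {} (\<lambda>x\<in>carrier (UV n k). x)"
    by (auto simp: is_twist_def uv_endo_def uv_twist_def hom_def)
  then show ?thesis by (simp add: is_twist_iff)
qed

lemma compose_twist:
  "compose (carrier (UV n k)) (twist n k K) (twist n k L) = twist n k (sym_diff K L)"
proof -
  interpret UV: uv_system "UV n k" n k "uv_rho n k" "uv_sigma n k" by (rule uv_system_UV)
  have K: "is_twist n k K (twist n k K)" and L: "is_twist n k L (twist n k L)"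
    by (rule is_twist_twist)+
  interpret K: group_hom "UV n k" "UV n k" "twist n k K"
    using K by unfold_locales (simp add: is_twist_def uv_endo_def)
  interpret L: group_hom "UV n k" "UV n k" "twist n k L"
    using L by unfold_locales (simp add: is_twist_def uv_endo_def)
  have "compose (carrier (UV n k)) (twist n k K) (twist n k L) \<in> hom (UV n k) (UV n k)"
    by (auto simp: hom_def compose_def)
  then have "is_twist n k (sym_diff K L) (compose (carrier (UV n k)) (twist n k K) (twist n k L))"
    using K L UV.r_invol
    by (simp add: is_twist_def uv_endo_def compose_eq K.hom_uv_twist UV.uv_twist_twist Un_commute)
  then show ?thesis by (simp add: is_twist_iff)
qed

text \<open>A twist is its own inverse, as \<open>sym_diff K K = {}\<close>.\<close>

lemma twist_auto: "twist n k K \<in> auto (UV n k)"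
proof -
  have t: "twist n k K \<in> hom (UV n k) (UV n k)" "twist n k K \<in> extensional (carrier (UV n k))"
    using is_twist_twist[of n k K] by (auto simp: is_twist_def uv_endo_def)
  then have closed: "twist n k K x \<in> carrier (UV n k)" if "x \<in> carrier (UV n k)" for x
    using that by (auto simp: hom_def)
  have "twist n k K (twist n k K x) = x" if "x \<in> carrier (UV n k)" for x
    using fun_cong[OF compose_twist[of n k K K], of x] that by (simp add: compose_eq twist_empty)
  then have "bij_betw (twist n k K) (carrier (UV n k)) (carrier (UV n k))"
    using closed by (intro bij_betw_byWitness[where f' = "twist n k K"]) auto
  with t show ?thesis by (simp add: auto_def Bij_def)
qed


section \<open>Nontrivial twists are not inner\<close>

lemma exponent_sum_system: "uv_system integer_group n k (\<lambda>i. 0) (\<lambda>i t. 1)"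
proof -
  interpret group integer_group by simp
  show ?thesis by unfold_locales simp_all
qed

lemma carrier_BijGroup_UNIV: "f \<in> carrier (BijGroup UNIV) \<longleftrightarrow> bij f"
  by (simp add: BijGroup_def Bij_def)

lemma mult_BijGroup_UNIV: "bij f \<Longrightarrow> bij g \<Longrightarrow> f \<otimes>\<^bsub>BijGroup UNIV\<^esub> g = f \<circ> g"
  by (simp add: BijGroup_def Bij_def compose_def fun_eq_iff)

text \<open>Signed permutations act on pairs of a position and a sign.\<close>

definition pos_swap :: "nat \<Rightarrow> nat \<times> bool \<Rightarrow> nat \<times> bool"
  where "pos_swap i = (\<lambda>(j, b). (transpose i (i+1) j, b))"

definition sign_flip :: "nat \<Rightarrow> nat \<times> bool \<Rightarrow> nat \<times> bool"
  where "sign_flip i = (\<lambda>(j, b). (j, if j = i then \<not> b else b))"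

lemma pos_swap_invol: "pos_swap i \<circ> pos_swap i = id"
  by (auto simp: pos_swap_def)

lemma sign_flip_invol: "sign_flip i \<circ> sign_flip i = id"
  by (auto simp: sign_flip_def)

lemma bij_pos_swap [simp]: "bij (pos_swap i)" and bij_sign_flip [simp]: "bij (sign_flip i)"
  using o_bij[OF pos_swap_invol pos_swap_invol] o_bij[OF sign_flip_invol sign_flip_invol] .

text \<open>The sign change at \<open>i\<close> commutes with every swap that fixes \<open>i\<close>, and \<open>\<rho>\<^sub>i \<rho>\<^sub>i\<^sub>+\<^sub>1\<close> carries position \<open>i\<close>
  to position \<open>i + 1\<close>, whence the relations. Conjugation by \<open>\<rho>\<^sub>i\<close> moves the sign change from \<open>i\<close> to
  \<open>i + 1\<close>, so this representation sees \<open>\<zeta>\<^sub>l\<close>.\<close>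

lemma signed_permutation_system:
  "uv_system (BijGroup UNIV) n k pos_swap (\<lambda>i t. sign_flip i)"
proof -
  interpret group "BijGroup UNIV" by (rule group_BijGroup)
  have [simp]: "\<one>\<^bsub>BijGroup UNIV\<^esub> = id" by (simp add: BijGroup_def fun_eq_iff)
  show ?thesis
    by unfold_locales (auto simp: carrier_BijGroup_UNIV mult_BijGroup_UNIV bij_comp
        pos_swap_invol, auto simp: fun_eq_iff pos_swap_def sign_flip_def transpose_def)
qed

text \<open>Each nonempty \<open>K\<close> is detected by one of the two representations above: by the exponent sum if
  \<open>k + 1 \<in> K\<close>, since the image of \<open>\<sigma>\<^sub>1\<^sub>,\<^sub>1\<close> changes from \<open>1\<close> to \<open>-1\<close>, and by the signed permutations
  otherwise.\<close>

theorem twist_not_inner: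
  assumes n: "n \<ge> 3" and k: "k \<ge> 1" and K: "K \<subseteq> {1..k+1}" "K \<noteq> {}"
  shows "twist n k K \<notin> Inn (UV n k)"
proof
  let ?U = "UV n k" and ?r = "uv_rho n k" and ?s = "uv_sigma n k"
  interpret UV: uv_system ?U n k ?r ?s by (rule uv_system_UV)
  assume "twist n k K \<in> Inn ?U"
  then obtain g where g: "g \<in> carrier ?U" and tw: "twist n k K = inner_aut ?U g"
    by (auto simp: Inn_def)
  have conj: "g \<otimes>\<^bsub>?U\<^esub> x = twist n k K x \<otimes>\<^bsub>?U\<^esub> g" if "x \<in> carrier ?U" for x
    using that g by (simp add: tw inner_aut_def UV.m_assoc)
  have tK: "twist n k K (?r i) = ?r i"
    "t \<in> {1..k} \<Longrightarrow> twist n k K (?s i t) = uv_twist ?U k K t (?r i) (?s i t)" if "i \<in> {1..n-1}" for i t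
    using is_twist_twist[of n k K] that by (auto simp: is_twist_def)
  have idx: "1 \<in> {1..n-1}" "2 \<in> {1..n-1}" "1 \<in> {1..k}" using n k by auto
  show False
  proof (cases "k + 1 \<in> K")
    case True
    obtain \<psi> where \<psi>: "\<psi> \<in> hom ?U integer_group" "\<And>i. i \<in> {1..n-1} \<Longrightarrow> \<psi> (?r i) = 0"
      "\<And>i t. i \<in> {1..n-1} \<Longrightarrow> t \<in> {1..k} \<Longrightarrow> \<psi> (?s i t) = 1"
      by (rule uv_system.UV_hom_exists[OF exponent_sum_system]) blast
    interpret Z: group integer_group by simp
    interpret \<psi>: group_hom ?U integer_group \<psi> by unfold_locales (rule \<psi>(1))
    have "\<psi> (g \<otimes>\<^bsub>?U\<^esub> ?s 1 1) = \<psi> (twist n k K (?s 1 1) \<otimes>\<^bsub>?U\<^esub> g)"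
      using idx by (simp only: conj UV.s_closed)
    then have "\<psi> (?s 1 1) = \<psi> (twist n k K (?s 1 1))"
      using idx g by (simp add: tK)
    then show False
      using idx True by (simp add: tK \<psi>.hom_uv_twist \<psi>(2,3)) (simp add: uv_twist_def Let_def split: if_splits)
  next
    case False
    then have "K \<subseteq> {1..k}" using K(1) by (auto simp: atLeastAtMostSuc_conv)
    then obtain l where l: "l \<in> K" "l \<in> {1..k}" using K(2) by blast
    let ?H = "BijGroup (UNIV :: (nat \<times> bool) set)"
    obtain \<psi> where \<psi>: "\<psi> \<in> hom ?U ?H" "\<And>i. i \<in> {1..n-1} \<Longrightarrow> \<psi> (?r i) = pos_swap i"
      "\<And>i t. i \<in> {1..n-1} \<Longrightarrow> t \<in> {1..k} \<Longrightarrow> \<psi> (?s i t) = sign_flip i"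
      by (rule uv_system.UV_hom_exists[OF signed_permutation_system]) blast
    interpret H: group ?H by (rule group_BijGroup)
    interpret \<psi>: group_hom ?U ?H \<psi> by unfold_locales (rule \<psi>(1))
    define c where "c = pos_swap 1 \<otimes>\<^bsub>?H\<^esub> sign_flip 1 \<otimes>\<^bsub>?H\<^esub> pos_swap 1"
    have c: "c = sign_flip 2"
      by (simp add: c_def mult_BijGroup_UNIV bij_comp)
        (auto simp: fun_eq_iff pos_swap_def sign_flip_def transpose_def)
    have G: "\<psi> g \<in> carrier ?H" using g by simp
    note cl = carrier_BijGroup_UNIV
    \<comment> \<open>Since \<open>\<psi> g\<close> intertwines \<open>pos_swap 2\<close> with itself and \<open>sign_flip 1\<close> with \<open>c\<close>, it turns the
      commutation of \<open>pos_swap 2\<close> with \<open>sign_flip 1\<close> into one with \<open>c = sign_flip 2\<close>.\<close>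
    have 1: "\<psi> g \<otimes>\<^bsub>?H\<^esub> pos_swap 2 = pos_swap 2 \<otimes>\<^bsub>?H\<^esub> \<psi> g"
    proof -
      have "\<psi> (g \<otimes>\<^bsub>?U\<^esub> ?r 2) = \<psi> (?r 2 \<otimes>\<^bsub>?U\<^esub> g)"
        using idx by (simp only: conj UV.r_closed tK)
      then show ?thesis using idx g by (simp only: \<psi>.hom_mult UV.r_closed \<psi>(2))
    qed
    have "\<psi> g \<otimes>\<^bsub>?H\<^esub> \<psi> (?s 1 l) = \<psi> (twist n k K (?s 1 l)) \<otimes>\<^bsub>?H\<^esub> \<psi> g"
    proof -
      have "\<psi> (g \<otimes>\<^bsub>?U\<^esub> ?s 1 l) = \<psi> (twist n k K (?s 1 l) \<otimes>\<^bsub>?U\<^esub> g)"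
        using idx l by (simp only: conj UV.s_closed)
      then show ?thesis using idx l g
        by (simp only: \<psi>.hom_mult UV.s_closed UV.r_closed tK UV.uv_twist_closed)
    qed
    then have 2: "\<psi> g \<otimes>\<^bsub>?H\<^esub> sign_flip 1 = c \<otimes>\<^bsub>?H\<^esub> \<psi> g"
      using idx l False by (simp add: tK \<psi>.hom_uv_twist \<psi>(2,3)) (simp add: uv_twist_def c_def)
    have "pos_swap 2 \<otimes>\<^bsub>?H\<^esub> sign_flip 1 = sign_flip 1 \<otimes>\<^bsub>?H\<^esub> pos_swap 2"
      by (simp add: mult_BijGroup_UNIV)
        (auto simp: fun_eq_iff pos_swap_def sign_flip_def transpose_def)
    then have "\<psi> g \<otimes>\<^bsub>?H\<^esub> (pos_swap 2 \<otimes>\<^bsub>?H\<^esub> sign_flip 1) = \<psi> g \<otimes>\<^bsub>?H\<^esub> (sign_flip 1 \<otimes>\<^bsub>?H\<^esub> pos_swap 2)"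
      by simp
    then have "(pos_swap 2 \<otimes>\<^bsub>?H\<^esub> c) \<otimes>\<^bsub>?H\<^esub> \<psi> g = (c \<otimes>\<^bsub>?H\<^esub> pos_swap 2) \<otimes>\<^bsub>?H\<^esub> \<psi> g"
      using H.intertwine_mult[OF G _ _ _ _ 1 2] H.intertwine_mult[OF G _ _ _ _ 2 1]
      by (simp only: c cl bij_pos_swap bij_sign_flip)
    then have "pos_swap 2 \<otimes>\<^bsub>?H\<^esub> c = c \<otimes>\<^bsub>?H\<^esub> pos_swap 2"
      by (rule H.right_cancel[THEN iffD1, rotated -1])
        (use G in \<open>simp_all only: c cl bij_pos_swap bij_sign_flip mult_BijGroup_UNIV bij_comp\<close>)
    then have "(pos_swap 2 \<circ> sign_flip 2) (2, True) = (sign_flip 2 \<circ> pos_swap 2) (2, True)"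
      by (simp add: c mult_BijGroup_UNIV)
    then show False by (simp add: pos_swap_def sign_flip_def)
  qed
qed


section \<open>Elementary abelian 2-groups\<close>

text \<open>A homomorphism \<open>F\<close> from the power set of \<open>I\<close> under symmetric difference with trivial kernel is
  injective, and singletons generate the power set because \<open>I\<close> is finite. The power set is
  identified with the product of copies of \<open>\<int>/2\<close> through indicator functions.\<close>

lemma (in group) subgroup_generated_power_set_iso:
  assumes I: "finite I"
    and closed: "\<And>K. K \<subseteq> I \<Longrightarrow> F K \<in> carrier G"
    and mult: "\<And>K L. K \<subseteq> I \<Longrightarrow> L \<subseteq> I \<Longrightarrow> F K \<otimes> F L = F (sym_diff K L)"
    and nontriv: "\<And>K. K \<subseteq> I \<Longrightarrow> K \<noteq> {} \<Longrightarrow> F K \<noteq> \<one>"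
  shows "subgroup_generated G ((\<lambda>i. F {i}) ` I) \<cong> product_group I (\<lambda>_. integer_mod_group 2)"
proof -
  let ?P = "product_group I (\<lambda>_. integer_mod_group 2)" and ?A = "(\<lambda>i. F {i}) ` I"
  let ?\<phi> = "\<lambda>x. F {i \<in> I. x i = (1::int)}"
  have one: "F {} = \<one>" using mult[of "{}" "{}"] closed[of "{}"] by simp
  have inj: "K = L" if KL: "K \<subseteq> I" "L \<subseteq> I" and eq: "F K = F L" for K L
  proof -
    have "F (sym_diff K L) = F K \<otimes> F K" using mult[OF KL] eq by simp
    also have "\<dots> = \<one>" using mult[OF KL(1) KL(1)] one by simp
    finally have "sym_diff K L = {}" using nontriv[of "sym_diff K L"] KL by blast
    then show ?thesis by blast
  qed
  have A: "?A \<subseteq> carrier G" using closed by blast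
  have gen: "F K \<in> generate G ?A" if "K \<subseteq> I" for K
    using finite_subset[OF that I] that
  proof (induction K rule: finite_induct)
    case empty
    then show ?case by (simp add: one generate.one)
  next
    case (insert i K)
    then have "F (insert i K) = F {i} \<otimes> F K" using mult[of "{i}" K] by (simp add: insert_Diff_if)
    then show ?case using insert by (auto intro: generate.eng generate.incl)
  qed
  have "subgroup (F ` Pow I) G"
  proof (rule subgroupI)
    fix a b assume "a \<in> F ` Pow I" "b \<in> F ` Pow I"
    then obtain K L where KL: "K \<subseteq> I" "L \<subseteq> I" "a = F K" "b = F L" by blast
    then have "inv a = a" using mult[of K K] closed[of K] one by (intro inv_equality) auto
    then show "inv a \<in> F ` Pow I" using KL by blast
    have "a \<otimes> b = F (sym_diff K L)" using KL mult by simp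
    moreover have "sym_diff K L \<subseteq> I" using KL by blast
    ultimately show "a \<otimes> b \<in> F ` Pow I" by blast
  qed (use closed in auto)
  then have "generate G ?A \<subseteq> F ` Pow I" by (rule generate_subgroup_incl[rotated]) auto
  with gen have carr: "generate G ?A = F ` Pow I" by auto
  have "?\<phi> \<in> iso ?P (subgroup_generated G ?A)"
  proof (rule isoI)
    show "?\<phi> \<in> hom ?P (subgroup_generated G ?A)"
    proof (rule homI)
      fix x y assume x: "x \<in> carrier ?P" and y: "y \<in> carrier ?P"
      have val: "z i = 0 \<or> z i = 1" if "z \<in> carrier ?P" "i \<in> I" for z i
        using that by (auto simp: PiE_iff carrier_integer_mod_group)
      have "{i \<in> I. (x \<otimes>\<^bsub>?P\<^esub> y) i = 1} = sym_diff {i \<in> I. x i = 1} {i \<in> I. y i = 1}"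
        using val[OF x] val[OF y] by fastforce
      then show "?\<phi> (x \<otimes>\<^bsub>?P\<^esub> y) = ?\<phi> x \<otimes>\<^bsub>subgroup_generated G ?A\<^esub> ?\<phi> y"
        using mult[of "{i \<in> I. x i = 1}" "{i \<in> I. y i = 1}"]
        by (simp add: subgroup_generated_def)
    qed (use A in \<open>auto simp: carrier_subgroup_generated Int_absorb1 carr\<close>)
    show "bij_betw ?\<phi> (carrier ?P) (carrier (subgroup_generated G ?A))"
    proof (rule bij_betw_imageI)
      show "inj_on ?\<phi> (carrier ?P)"
      proof (rule inj_onI)
        fix x y assume xy: "x \<in> carrier ?P" "y \<in> carrier ?P" and "?\<phi> x = ?\<phi> y"
        then have eq: "{i \<in> I. x i = 1} = {i \<in> I. y i = 1}" by (intro inj) auto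
        show "x = y"
        proof (rule PiE_ext)
          show "x \<in> PiE I (\<lambda>_. carrier (integer_mod_group 2))"
            "y \<in> PiE I (\<lambda>_. carrier (integer_mod_group 2))" using xy by simp_all
          fix i assume i: "i \<in> I"
          then have "x i \<in> {0..<2}" "y i \<in> {0..<2}"
            using xy by (auto simp: PiE_iff carrier_integer_mod_group)
          moreover have "x i = 1 \<longleftrightarrow> y i = 1" using eq i by blast
          ultimately show "x i = y i" by auto
        qed
      qed
      have "F K \<in> ?\<phi> ` carrier ?P" if "K \<subseteq> I" for K
      proof (rule image_eqI)
        have "{i \<in> I. (\<lambda>i\<in>I. if i \<in> K then 1 else (0::int)) i = 1} = K" using that by auto
        then show "F K = ?\<phi> (\<lambda>i\<in>I. if i \<in> K then 1 else (0::int))" by (simp only:)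
        show "(\<lambda>i\<in>I. if i \<in> K then 1 else (0::int)) \<in> carrier ?P"
          by (auto simp: carrier_integer_mod_group)
      qed
      then show "?\<phi> ` carrier ?P = carrier (subgroup_generated G ?A)"
        using A by (auto simp: carrier_subgroup_generated Int_absorb1 carr)
    qed
  qed
  then have "?P \<cong> subgroup_generated G ?A" by (rule is_isoI)
  then show ?thesis by (rule group.iso_sym[rotated]) simp
qed


section \<open>The outer automorphisms induced by \<open>\<theta>\<close> and the \<open>\<zeta>\<^sub>l\<close>\<close>

lemma out_class_mult:
  assumes "group G" "f \<in> auto G" "h \<in> auto G"
  shows "out_class G f \<otimes>\<^bsub>Out G\<^esub> out_class G h = out_class G (compose (carrier G) f h)"
  using normal.rcos_sum[OF group.Inn_normal[OF assms(1)], of f h] assms(2,3)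
  by (simp add: out_class_def Out_def carrier_AutoGroup mult_AutoGroup)

lemma out_class_closed: "f \<in> auto G \<Longrightarrow> out_class G f \<in> carrier (Out G)"
  by (auto simp: out_class_def Out_def carrier_FactGroup carrier_AutoGroup)

lemma out_class_eq_one_iff:
  assumes "group G" "f \<in> auto G"
  shows "out_class G f = \<one>\<^bsub>Out G\<^esub> \<longleftrightarrow> f \<in> Inn G"
proof -
  interpret A: group "AutoGroup G" using assms(1) by (rule group.AutoGroup)
  have "subgroup (Inn G) (AutoGroup G)"
    using group.Inn_normal[OF assms(1)] by (rule normal_imp_subgroup)
  then show ?thesis using assms(2) A.coset_join1 A.coset_join2
    by (auto simp: out_class_def Out_def carrier_AutoGroup dest: subgroup.subset)
qed

theorem theorem2p1:
  fixes n k :: nat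
  assumes "n \<ge> 3" and "k \<ge> 1"
  shows "(\<exists>!\<theta>. is_theta n k \<theta>) \<and> (\<forall>l\<in>{1..k}. \<exists>!f. is_zeta n k l f) \<and>
    (\<forall>\<theta> \<zeta>. is_theta n k \<theta> \<longrightarrow> (\<forall>l\<in>{1..k}. is_zeta n k l (\<zeta> l)) \<longrightarrow>
      \<theta> \<in> auto (UV n k) \<and> (\<forall>l\<in>{1..k}. \<zeta> l \<in> auto (UV n k)) \<and>
      (let A = insert (out_class (UV n k) \<theta>) ((\<lambda>l. out_class (UV n k) (\<zeta> l)) ` {1..k}) in
        (\<forall>x\<in>A. x \<noteq> \<one>\<^bsub>Out (UV n k)\<^esub> \<and> x \<otimes>\<^bsub>Out (UV n k)\<^esub> x = \<one>\<^bsub>Out (UV n k)\<^esub>) \<and>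
        (\<forall>x\<in>A. \<forall>y\<in>A. x \<otimes>\<^bsub>Out (UV n k)\<^esub> y = y \<otimes>\<^bsub>Out (UV n k)\<^esub> x) \<and>
        subgroup_generated (Out (UV n k)) A \<cong> product_group {1..k+1} (\<lambda>_. integer_mod_group 2)))"
proof -
  let ?U = "UV n k" and ?O = "Out (UV n k)"
  interpret UV: uv_system ?U n k "uv_rho n k" "uv_sigma n k" by (rule uv_system_UV)
  interpret O: group ?O by (rule UV.group_Out)
  define F where "F K = out_class ?U (twist n k K)" for K
  have closed: "F K \<in> carrier ?O" for K by (simp add: F_def out_class_closed twist_auto)
  have mult: "F K \<otimes>\<^bsub>?O\<^esub> F L = F (sym_diff K L)" for K L
    by (simp add: F_def out_class_mult UV.is_group twist_auto compose_twist)
  have nontriv: "F K \<noteq> \<one>\<^bsub>?O\<^esub>" if "K \<subseteq> {1..k+1}" "K \<noteq> {}" for K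
    using twist_not_inner[OF assms that]
    by (simp add: F_def out_class_eq_one_iff UV.is_group twist_auto)
  have one: "F {} = \<one>\<^bsub>?O\<^esub>" using mult[of "{}" "{}"] closed[of "{}"] by simp
  have classes: "insert (F {k+1}) ((\<lambda>l. F {l}) ` {1..k}) = (\<lambda>l. F {l}) ` {1..k+1}"
    by (simp add: atLeastAtMostSuc_conv)
  have iso: "subgroup_generated ?O ((\<lambda>l. F {l}) ` {1..k+1})
      \<cong> product_group {1..k+1} (\<lambda>_. integer_mod_group 2)"
    by (rule O.subgroup_generated_power_set_iso) (simp_all add: closed mult nontriv)
  have invol: "F {l} \<noteq> \<one>\<^bsub>?O\<^esub> \<and> F {l} \<otimes>\<^bsub>?O\<^esub> F {l} = \<one>\<^bsub>?O\<^esub>" if "l \<in> {1..k+1}" for l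
    using nontriv[of "{l}"] that mult[of "{l}" "{l}"] one by simp
  have comm: "F K \<otimes>\<^bsub>?O\<^esub> F L = F L \<otimes>\<^bsub>?O\<^esub> F K" for K L
    by (simp add: mult Un_commute)
  show ?thesis
  proof (intro conjI ballI allI impI)
    show "\<exists>!\<theta>. is_theta n k \<theta>" by (simp add: is_theta_iff)
    show "\<exists>!f. is_zeta n k l f" if "l \<in> {1..k}" for l using that by (simp add: is_zeta_iff)
    fix \<theta> \<zeta> assume "is_theta n k \<theta>" and "\<forall>l\<in>{1..k}. is_zeta n k l (\<zeta> l)"
    then have \<theta>: "\<theta> = twist n k {k+1}" and \<zeta>: "\<And>l. l \<in> {1..k} \<Longrightarrow> \<zeta> l = twist n k {l}"
      by (simp_all add: is_theta_iff is_zeta_iff)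
    show "\<theta> \<in> auto ?U" by (simp add: \<theta> twist_auto)
    show "\<zeta> l \<in> auto ?U" if "l \<in> {1..k}" for l using that by (simp add: \<zeta> twist_auto)
    have "(\<lambda>l. out_class ?U (\<zeta> l)) ` {1..k} = (\<lambda>l. F {l}) ` {1..k}"
      by (intro image_cong) (simp_all add: \<zeta> F_def)
    then have A: "insert (out_class ?U \<theta>) ((\<lambda>l. out_class ?U (\<zeta> l)) ` {1..k})
        = (\<lambda>l. F {l}) ` {1..k+1}"
      using classes by (simp add: \<theta> F_def)
    show "let A = insert (out_class ?U \<theta>) ((\<lambda>l. out_class ?U (\<zeta> l)) ` {1..k}) in
        (\<forall>x\<in>A. x \<noteq> \<one>\<^bsub>?O\<^esub> \<and> x \<otimes>\<^bsub>?O\<^esub> x = \<one>\<^bsub>?O\<^esub>) \<and>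
        (\<forall>x\<in>A. \<forall>y\<in>A. x \<otimes>\<^bsub>?O\<^esub> y = y \<otimes>\<^bsub>?O\<^esub> x) \<and>
        subgroup_generated ?O A \<cong> product_group {1..k+1} (\<lambda>_. integer_mod_group 2)"
      unfolding A Let_def using iso invol comm by blast
  qed
qed

end
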